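(* Let $X$ be a weakly sober space and let $U\subseteq X$ be a saturated subset. Then $U$ with the subspace topology is weakly sober.
   Context: For a topological space $X$, the specialization preorder is $x\le y$ iff $x\in\mathrm{cl}\{y\}$; all order-theoretic notions in $X$ refer to it (for a subspace, to the specialization preorder of the subspace, with bounds taken inside the subspace). For $A\subseteq X$, $A^{\uparrow}$ and $A^{\downarrow}$ denote the sets of all upper, respectively lower, bounds of $A$ in $X$, and $A^{\delta}=(A^{\uparrow})^{\downarrow}$ is the cut closure of $A$; $A$ is a cut if $A=A^{\delta}$. Irreducible closed sets are nonempty. $X$ is weakly sober if it is $T_0$ and every irreducible closed subset $A$ of $X$ is a cut, i.e. an intersection of point closures (the whole space being the empty intersection). A subset is saturated if it is an intersection of open sets, equivalently an upper set for the specialization order. *)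

theory Defs
  imports "HOL-Analysis.Analysis"
begin

text \<open>If \<open>y\<close> lies outside the space, the closure of \<open>{y}\<close> is empty, so the
  specialization preorder only relates points of the space.\<close>

definition spec_le :: "'a topology \<Rightarrow> 'a \<Rightarrow> 'a \<Rightarrow> bool" where
  "spec_le X x y \<longleftrightarrow> x \<in> X closure_of {y}"

definition upper_bounds :: "'a topology \<Rightarrow> 'a set \<Rightarrow> 'a set" where
  "upper_bounds X A = {y \<in> topspace X. \<forall>a\<in>A. spec_le X a y}"

definition lower_bounds :: "'a topology \<Rightarrow> 'a set \<Rightarrow> 'a set" where
  "lower_bounds X A = {x \<in> topspace X. \<forall>a\<in>A. spec_le X x a}"

definition cut_closure :: "'a topology \<Rightarrow> 'a set \<Rightarrow> 'a set" where
  "cut_closure X A = lower_bounds X (upper_bounds X A)"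

definition is_cut :: "'a topology \<Rightarrow> 'a set \<Rightarrow> bool" where
  "is_cut X A \<longleftrightarrow> A \<subseteq> topspace X \<and> A = cut_closure X A"

definition irreducible_closed :: "'a topology \<Rightarrow> 'a set \<Rightarrow> bool" where
  "irreducible_closed X A \<longleftrightarrow>
     closedin X A \<and> A \<noteq> {} \<and>
     (\<forall>B C. closedin X B \<and> closedin X C \<and> A = B \<union> C \<longrightarrow> A = B \<or> A = C)"

definition weakly_sober :: "'a topology \<Rightarrow> bool" where
  "weakly_sober X \<longleftrightarrow> t0_space X \<and> (\<forall>A. irreducible_closed X A \<longrightarrow> is_cut X A)"

text \<open>Intersecting with the carrier makes the empty intersection the whole space.\<close>

definition saturated :: "'a topology \<Rightarrow> 'a set \<Rightarrow> bool" where
  "saturated X U \<longleftrightarrow> (\<exists>\<V>. (\<forall>V\<in>\<V>. openin X V) \<and> U = topspace X \<inter> \<Inter>\<V>)"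

end

theory Submission
  imports Defs
begin

text \<open>Let \<open>A\<close> be irreducible and closed in \<open>U\<close>. Its closure in \<open>X\<close> is irreducible, hence a cut,
  and meets \<open>U\<close> in \<open>A\<close>. It has the same upper bounds as \<open>A\<close>, because point closures are closed,
  and these all lie in \<open>U\<close>, because \<open>A\<close> is nonempty and \<open>U\<close> is an upper set.
  So the cut closure of \<open>A\<close> in \<open>U\<close> is the trace on \<open>U\<close> of its closure in \<open>X\<close>, that is, \<open>A\<close>.\<close>

text \<open>Since \<open>a\<close> is in the closure of \<open>{y}\<close>, every open set
  containing \<open>a\<close> contains \<open>y\<close>; this applies to each member of the family
  that cuts out \<open>U\<close>.\<close>

lemma saturated_upward_closed:
  assumes "saturated X U" "a \<in> U" "spec_le X a y" "y \<in> topspace X"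
  shows "y \<in> U"
  using assms unfolding saturated_def spec_le_def in_closure_of by auto

lemma spec_le_subtopology:
  assumes "x \<in> U" "y \<in> U"
  shows "spec_le (subtopology X U) x y \<longleftrightarrow> spec_le X x y"
  using assms by (simp add: spec_le_def closure_of_subtopology)

lemma upper_bounds_closure_of:
  assumes "A \<subseteq> topspace X"
  shows "upper_bounds X (X closure_of A) = upper_bounds X A"
proof -
  have "X closure_of A \<subseteq> X closure_of {y} \<longleftrightarrow> A \<subseteq> X closure_of {y}" for y
    using assms closure_of_subset[of A X] closure_of_minimal[of A "X closure_of {y}" X] by auto
  then show ?thesis
    unfolding upper_bounds_def spec_le_def by blast
qed

lemma closedin_subtopology_closure_of:
  assumes "closedin (subtopology X U) A"
  shows "A = U \<inter> X closure_of A"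
proof -
  have "A \<subseteq> U"
    using closedin_subset[OF assms] by simp
  then show ?thesis
    using closure_of_closedin[OF assms] by (simp add: closure_of_subtopology Int_absorb1)
qed

text \<open>A splitting of the closure into closed sets \<open>P\<close> and \<open>Q\<close>
  restricts to a splitting of \<open>A\<close> by their traces on \<open>U\<close>. If one trace is
  all of \<open>A\<close>, that closed set contains \<open>A\<close> and therefore its
  closure.\<close>

lemma irreducible_closed_closure_of:
  assumes "irreducible_closed (subtopology X U) A"
  shows "irreducible_closed X (X closure_of A)"
proof -
  have clA: "closedin (subtopology X U) A" and "A \<noteq> {}"
    using assms by (auto simp: irreducible_closed_def)
  have AX: "A \<subseteq> topspace X"
    using closedin_subset[OF clA] by simp
  have A: "A = U \<inter> X closure_of A"
    using closedin_subtopology_closure_of[OF clA] .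
  have "X closure_of A = P \<or> X closure_of A = Q"
    if P: "closedin X P" and Q: "closedin X Q" and PQ: "X closure_of A = P \<union> Q" for P Q
  proof -
    have "A = (U \<inter> P) \<union> (U \<inter> Q)"
      using A PQ by blast
    moreover have "closedin (subtopology X U) (U \<inter> P)" "closedin (subtopology X U) (U \<inter> Q)"
      using P Q by (auto simp: closedin_subtopology)
    ultimately have "A = U \<inter> P \<or> A = U \<inter> Q"
      using assms unfolding irreducible_closed_def by blast
    then have "X closure_of A \<subseteq> P \<or> X closure_of A \<subseteq> Q"
      using P Q closure_of_minimal[of A P X] closure_of_minimal[of A Q X] by blast
    then show ?thesis
      using PQ by blast
  qed
  then show ?thesis
    using \<open>A \<noteq> {}\<close> closure_of_subset[OF AX] unfolding irreducible_closed_def by auto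
qed

lemma upper_bounds_subtopology_saturated:
  assumes "saturated X U" "A \<subseteq> U" "A \<noteq> {}"
  shows "upper_bounds (subtopology X U) A = upper_bounds X A"
proof (intro equalityI subsetI)
  fix y assume "y \<in> upper_bounds (subtopology X U) A"
  then show "y \<in> upper_bounds X A"
    using assms(2) by (auto simp: upper_bounds_def spec_le_subtopology subset_iff)
next
  fix y assume y: "y \<in> upper_bounds X A"
  \<comment> \<open>For empty \<open>A\<close>, every point of \<open>X\<close> would be an upper
    bound, inside \<open>U\<close> or not.\<close>
  then have "y \<in> U"
    using assms saturated_upward_closed[of X U] unfolding upper_bounds_def by blast
  then show "y \<in> upper_bounds (subtopology X U) A"
    using y assms(2) by (auto simp: upper_bounds_def spec_le_subtopology subset_iff)
qed

text \<open>A point of \<open>B\<close> outside \<open>U\<close> would have empty closure in the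
  subspace, hence nothing below it there.\<close>

lemma lower_bounds_subtopology:
  assumes "B \<subseteq> U"
  shows "lower_bounds (subtopology X U) B = U \<inter> lower_bounds X B"
  using assms by (auto simp: lower_bounds_def spec_le_subtopology subset_iff)

theorem proposition3p3:
  fixes X :: "'a topology" and U :: "'a set"
  assumes "weakly_sober X"
    and "saturated X U"
  shows "weakly_sober (subtopology X U)"
  unfolding weakly_sober_def
proof (intro conjI allI impI)
  show "t0_space (subtopology X U)"
    using assms(1) t0_space_subtopology by (auto simp: weakly_sober_def)
next
  fix A assume irr: "irreducible_closed (subtopology X U) A"
  then have clA: "closedin (subtopology X U) A" and "A \<noteq> {}"
    by (auto simp: irreducible_closed_def)
  have sub: "A \<subseteq> topspace (subtopology X U)"
    using closedin_subset[OF clA] .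
  then have AX: "A \<subseteq> topspace X" and AU: "A \<subseteq> U"
    by auto
  have ub: "upper_bounds (subtopology X U) A = upper_bounds X A"
    using upper_bounds_subtopology_saturated[OF assms(2) AU \<open>A \<noteq> {}\<close>] .
  \<comment> \<open>Bounds taken in the subspace lie in \<open>U\<close> by definition;
    \<open>ub\<close> read backwards carries this over to \<open>X\<close>, as
    \<open>lower_bounds_subtopology\<close> requires.\<close>
  have "upper_bounds X A \<subseteq> U"
    unfolding ub[symmetric] by (auto simp: upper_bounds_def)
  then have "cut_closure (subtopology X U) A = U \<inter> cut_closure X A"
    by (simp add: cut_closure_def ub lower_bounds_subtopology)
  also have "cut_closure X A = cut_closure X (X closure_of A)"
    by (simp add: cut_closure_def upper_bounds_closure_of[OF AX])
  also have "\<dots> = X closure_of A"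
    using irreducible_closed_closure_of[OF irr] assms(1)
    by (metis weakly_sober_def is_cut_def)
  also have "U \<inter> X closure_of A = A"
    using closedin_subtopology_closure_of[OF clA] by simp
  finally show "is_cut (subtopology X U) A"
    using sub by (simp add: is_cut_def)
qed

end
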